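(* Let $\mu\in\mathcal{M}(\Phi)$ and let $\Phi_r$ be a time reparameterization of $\Phi$ with an associated function $r\in L^1(M,\mu)$. Then for $\mu$-almost every $x$ we have $$\underline R(\Phi_r,x)=\underline R(\Phi,x)\quad\text{and}\quad \overline R(\Phi_r,x)=\overline R(\Phi,x).$$ If $\mu$ is non-atomic, then, given any $x\in M$, for $\mu$-almost every $y$ we have $$\underline R(\Phi_r,x,y)=\underline R(\Phi,x,y)\quad\text{and}\quad\overline R(\Phi_r,x,y)=\overline R(\Phi,x,y).$$
   Context: Setting. $M$ is a manifold of class $C^m$, $m\ge 2$, with a Riemannian metric of class $C^{m-1}$ and induced distance $\rho$. $f$ is a $C^\ell$ vector field on $M$, $1\le \ell<m$, such that $dx/dt=f(x)$ generates a $C^\ell$ flow $\Phi=\{\varphi^t\}_{t\in\mathbb{R}}$. A $C^\ell$ flow $\Phi_r=\{\varphi^\tau_r\}_{\tau\in\mathbb{R}}$ on $M$ is a time reparameterization of $\Phi$ if for every $x$ the orbits of $x$ under both flows coincide and have the same orientation. Its associated function $r\ge0$ is positive and $C^{\ell-1}$ at every non-fixed point, where $\varphi_r^\tau(x)=\varphi^{t(x,\tau)}(x)$ and $r(x)=\big(\frac{\partial}{\partial\tau}t(x,\tau)|_{\tau=0}\big)^{-1}$. Thus $d\tau=r(x)\,dt$, and $\varphi_r^{\tau(x,t)}(x)=\varphi^t(x)$ with $\tau(x,t)=\int_0^tr(\varphi^s(x))\,ds$. $\mathcal M(\Phi)$ is the set of $\Phi$-invariant Borel probability measures on $M$. A measure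 $\mu\in\mathcal M(\Phi)$ is called non-atomic if it is not supported on a periodic orbit. Waiting times and recurrence rates. For $A\subset M$ and $y\in M$ let $e_A(\Phi,y)=\inf\{t>0:\varphi^t(y)\notin A\}$ be the escape time and $E_A(\Phi,y)=\inf\{t>e_A(\Phi,y):\varphi^t(y)\in A\}$ the time of first (re-)entrance into $A$ (with $\inf\emptyset=\infty$). With $B(x,\varepsilon)=\{z:\rho(x,z)<\varepsilon\}$, define $$\underline R(\Phi,x,y)=\liminf_{\varepsilon\to0}\frac{\log E_{B(x,\varepsilon)}(\Phi,y)}{-\log\varepsilon},\qquad \overline R(\Phi,x,y)=\limsup_{\varepsilon\to0}\frac{\log E_{B(x,\varepsilon)}(\Phi,y)}{-\log\varepsilon}.$$ If $E_{B(x,\varepsilon)}(\Phi,y)$ is infinite for some $\varepsilon$, both are set to be infinite. Put $\underline R(\Phi,x)=\underline R(\Phi,x,x)$ and $\overline R(\Phi,x)=\overline R(\Phi,x,x)$. The same definitions are used for $\Phi_r$. *)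

theory Defs
  imports "HOL-Probability.Probability"
begin

section \<open>Maps of class \<open>C\<^sup>k\<close>\<close>

text \<open>Meant for open \<open>S\<close>; \<open>k = 0\<close> is continuity.\<close>

primrec Ck_on :: "nat \<Rightarrow> 'e::euclidean_space set \<Rightarrow> ('e \<Rightarrow> 'f::real_normed_vector) \<Rightarrow> bool" where
  "Ck_on 0 S h \<longleftrightarrow> continuous_on S h"
| "Ck_on (Suc k) S h \<longleftrightarrow> (\<forall>x\<in>S. h differentiable (at x)) \<and>
     (\<forall>v. Ck_on k S (\<lambda>x. frechet_derivative h (at x) v))"

section \<open>Manifolds and tensor fields\<close>

text \<open>
  The manifold is the whole type \<open>'a\<close>, whose topology is Hausdorff and second countable. A chart
  is a pair of its domain and its coordinate map; the map is arbitrary outside the domain.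
\<close>

type_synonym ('a, 'e) chart = "'a set \<times> ('a \<Rightarrow> 'e)"

abbreviation chart_inv :: "('a, 'e) chart \<Rightarrow> 'e \<Rightarrow> 'a" where
  "chart_inv \<kappa> \<equiv> inv_into (fst \<kappa>) (snd \<kappa>)"

definition is_chart :: "('a::topological_space, 'e::euclidean_space) chart \<Rightarrow> bool" where
  "is_chart \<kappa> \<longleftrightarrow> open (fst \<kappa>) \<and> open (snd \<kappa> ` fst \<kappa>) \<and>
     homeomorphism (fst \<kappa>) (snd \<kappa> ` fst \<kappa>) (snd \<kappa>) (chart_inv \<kappa>)"

definition transition :: "('a, 'e) chart \<Rightarrow> ('a, 'e) chart \<Rightarrow> 'e \<Rightarrow> 'e" where
  "transition \<kappa> \<kappa>' = snd \<kappa>' \<circ> chart_inv \<kappa>"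

definition Ck_manifold ::
  "nat \<Rightarrow> ('a::{second_countable_topology, t2_space}, 'e::euclidean_space) chart set \<Rightarrow> bool" where
  "Ck_manifold m \<A> \<longleftrightarrow> (\<forall>\<kappa>\<in>\<A>. is_chart \<kappa>) \<and> (\<Union>\<kappa>\<in>\<A>. fst \<kappa>) = UNIV \<and>
     (\<forall>\<kappa>\<in>\<A>. \<forall>\<kappa>'\<in>\<A>. Ck_on m (snd \<kappa> ` (fst \<kappa> \<inter> fst \<kappa>')) (transition \<kappa> \<kappa>'))"

text \<open>
  The differential at (the coordinates of) \<open>x\<close> of the change of coordinates from \<open>\<kappa>\<close> to \<open>\<kappa>'\<close>.
\<close>

definition d_transition ::
  "('a, 'e::euclidean_space) chart \<Rightarrow> ('a, 'e) chart \<Rightarrow> 'a \<Rightarrow> 'e \<Rightarrow> 'e" where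
  "d_transition \<kappa> \<kappa>' x = frechet_derivative (transition \<kappa> \<kappa>') (at (snd \<kappa> x))"

text \<open>
  Tensor fields are given by their components in the charts, subject to the usual transformation
  rule: \<open>f \<kappa> x\<close> is the coordinate vector at \<open>x\<close> of the vector field in the chart \<open>\<kappa>\<close>, and
  \<open>g \<kappa> x\<close> is the bilinear form representing the metric at \<open>x\<close> in the chart \<open>\<kappa>\<close>.
\<close>

definition Ck_vector_field ::
  "nat \<Rightarrow> ('a, 'e::euclidean_space) chart set \<Rightarrow> (('a, 'e) chart \<Rightarrow> 'a \<Rightarrow> 'e) \<Rightarrow> bool" where
  "Ck_vector_field k \<A> f \<longleftrightarrow>
     (\<forall>\<kappa>\<in>\<A>. Ck_on k (snd \<kappa> ` fst \<kappa>) (f \<kappa> \<circ> chart_inv \<kappa>)) \<and>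
     (\<forall>\<kappa>\<in>\<A>. \<forall>\<kappa>'\<in>\<A>. \<forall>x \<in> fst \<kappa> \<inter> fst \<kappa>'. f \<kappa>' x = d_transition \<kappa> \<kappa>' x (f \<kappa> x))"

definition Ck_riemannian_metric ::
  "nat \<Rightarrow> ('a, 'e::euclidean_space) chart set \<Rightarrow>
    (('a, 'e) chart \<Rightarrow> 'a \<Rightarrow> 'e \<Rightarrow> 'e \<Rightarrow> real) \<Rightarrow> bool" where
  "Ck_riemannian_metric k \<A> g \<longleftrightarrow>
     (\<forall>\<kappa>\<in>\<A>. \<forall>x\<in>fst \<kappa>. bilinear (g \<kappa> x) \<and> (\<forall>u v. g \<kappa> x u v = g \<kappa> x v u) \<and>
        (\<forall>v. v \<noteq> 0 \<longrightarrow> 0 < g \<kappa> x v v)) \<and>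
     (\<forall>\<kappa>\<in>\<A>. \<forall>u v. Ck_on k (snd \<kappa> ` fst \<kappa>) (\<lambda>p. g \<kappa> (chart_inv \<kappa> p) u v)) \<and>
     (\<forall>\<kappa>\<in>\<A>. \<forall>\<kappa>'\<in>\<A>. \<forall>x \<in> fst \<kappa> \<inter> fst \<kappa>'. \<forall>u v.
        g \<kappa> x u v = g \<kappa>' x (d_transition \<kappa> \<kappa>' x u) (d_transition \<kappa> \<kappa>' x v))"

section \<open>The Riemannian distance\<close>

definition piecewise_C1_curve ::
  "('a::topological_space, 'e::euclidean_space) chart set \<Rightarrow> (real \<Rightarrow> 'a) \<Rightarrow> bool" where
  "piecewise_C1_curve \<A> \<gamma> \<longleftrightarrow> continuous_on {0..1} \<gamma> \<and>
     (\<exists>S. finite S \<and>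
       (\<forall>\<kappa>\<in>\<A>. (snd \<kappa> \<circ> \<gamma>) C1_differentiable_on ({t \<in> {0..1}. \<gamma> t \<in> fst \<kappa>} - S)))"

text \<open>The speed does not depend on the chosen chart around \<open>\<gamma> t\<close>, by the transformation rule.\<close>

definition speed ::
  "('a, 'e::euclidean_space) chart set \<Rightarrow> (('a, 'e) chart \<Rightarrow> 'a \<Rightarrow> 'e \<Rightarrow> 'e \<Rightarrow> real) \<Rightarrow>
    (real \<Rightarrow> 'a) \<Rightarrow> real \<Rightarrow> real" where
  "speed \<A> g \<gamma> t =
     (let \<kappa> = (SOME \<kappa>. \<kappa> \<in> \<A> \<and> \<gamma> t \<in> fst \<kappa>);
          v = vector_derivative (snd \<kappa> \<circ> \<gamma>) (at t)
      in sqrt (g \<kappa> (\<gamma> t) v v))"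

definition curve_length ::
  "('a, 'e::euclidean_space) chart set \<Rightarrow> (('a, 'e) chart \<Rightarrow> 'a \<Rightarrow> 'e \<Rightarrow> 'e \<Rightarrow> real) \<Rightarrow>
    (real \<Rightarrow> 'a) \<Rightarrow> ennreal" where
  "curve_length \<A> g \<gamma> = (\<integral>\<^sup>+t\<in>{0..1}. ennreal (speed \<A> g \<gamma> t) \<partial>lborel)"

text \<open>The distance between points of different components is \<open>\<infinity>\<close>.\<close>

definition riemannian_dist ::
  "('a::topological_space, 'e::euclidean_space) chart set \<Rightarrow>
    (('a, 'e) chart \<Rightarrow> 'a \<Rightarrow> 'e \<Rightarrow> 'e \<Rightarrow> real) \<Rightarrow> 'a \<Rightarrow> 'a \<Rightarrow> ennreal" where
  "riemannian_dist \<A> g x y =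
     Inf {curve_length \<A> g \<gamma> | \<gamma>. piecewise_C1_curve \<A> \<gamma> \<and> \<gamma> 0 = x \<and> \<gamma> 1 = y}"

section \<open>Flows and time reparameterizations\<close>

definition Ck_flow ::
  "nat \<Rightarrow> ('a::topological_space, 'e::euclidean_space) chart set \<Rightarrow> (real \<Rightarrow> 'a \<Rightarrow> 'a) \<Rightarrow> bool" where
  "Ck_flow k \<A> \<phi> \<longleftrightarrow>
     (\<forall>x. \<phi> 0 x = x) \<and> (\<forall>s t x. \<phi> (s + t) x = \<phi> s (\<phi> t x)) \<and>
     continuous_on UNIV (\<lambda>(t, x). \<phi> t x) \<and>
     (\<forall>\<kappa>\<in>\<A>. \<forall>\<kappa>'\<in>\<A>.
        Ck_on k {(t, p). p \<in> snd \<kappa> ` fst \<kappa> \<and> \<phi> t (chart_inv \<kappa> p) \<in> fst \<kappa>'}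
          (\<lambda>(t, p). snd \<kappa>' (\<phi> t (chart_inv \<kappa> p))))"

definition generated_by ::
  "('a, 'e::euclidean_space) chart set \<Rightarrow> (('a, 'e) chart \<Rightarrow> 'a \<Rightarrow> 'e) \<Rightarrow> (real \<Rightarrow> 'a \<Rightarrow> 'a) \<Rightarrow> bool" where
  "generated_by \<A> f \<phi> \<longleftrightarrow>
     (\<forall>\<kappa>\<in>\<A>. \<forall>x t. \<phi> t x \<in> fst \<kappa> \<longrightarrow>
        ((\<lambda>s. snd \<kappa> (\<phi> s x)) has_vector_derivative f \<kappa> (\<phi> t x)) (at t))"

definition orbit :: "(real \<Rightarrow> 'a \<Rightarrow> 'a) \<Rightarrow> 'a \<Rightarrow> 'a set" where
  "orbit \<phi> x = range (\<lambda>t. \<phi> t x)"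

definition fixed_points :: "(real \<Rightarrow> 'a \<Rightarrow> 'a) \<Rightarrow> 'a set" where
  "fixed_points \<phi> = {x. \<forall>t. \<phi> t x = x}"

text \<open>
  A time change along the orbit of \<open>x\<close>: \<open>\<theta> \<tau>\<close> is the time \<open>t(x,\<tau>)\<close> with \<open>\<psi> \<tau> x = \<phi> (t(x,\<tau>)) x\<close>.
  Continuity and \<open>\<theta> 0 = 0\<close> make it unique unless \<open>x\<close> is fixed, also on
  periodic orbits; strict monotonicity says that \<open>\<psi>\<close> and \<open>\<phi>\<close> orient the orbit in the same way.
\<close>

definition time_change ::
  "(real \<Rightarrow> 'a \<Rightarrow> 'a) \<Rightarrow> (real \<Rightarrow> 'a \<Rightarrow> 'a) \<Rightarrow> 'a \<Rightarrow> (real \<Rightarrow> real) \<Rightarrow> bool" where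
  "time_change \<phi> \<psi> x \<theta> \<longleftrightarrow> \<theta> 0 = 0 \<and> continuous_on UNIV \<theta> \<and> strict_mono \<theta> \<and>
     (\<forall>\<tau>. \<psi> \<tau> x = \<phi> (\<theta> \<tau>) x)"

definition time_reparameterization ::
  "nat \<Rightarrow> ('a::topological_space, 'e::euclidean_space) chart set \<Rightarrow>
    (real \<Rightarrow> 'a \<Rightarrow> 'a) \<Rightarrow> (real \<Rightarrow> 'a \<Rightarrow> 'a) \<Rightarrow> bool" where
  "time_reparameterization k \<A> \<phi> \<psi> \<longleftrightarrow> Ck_flow k \<A> \<psi> \<and>
     (\<forall>x. orbit \<psi> x = orbit \<phi> x \<and> (\<exists>\<theta>. time_change \<phi> \<psi> x \<theta>))"

text \<open>The values of \<open>r\<close> at the fixed points are only required to be nonnegative.\<close>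

definition associated_function ::
  "nat \<Rightarrow> ('a, 'e::euclidean_space) chart set \<Rightarrow>
    (real \<Rightarrow> 'a \<Rightarrow> 'a) \<Rightarrow> (real \<Rightarrow> 'a \<Rightarrow> 'a) \<Rightarrow> ('a \<Rightarrow> real) \<Rightarrow> bool" where
  "associated_function k \<A> \<phi> \<psi> r \<longleftrightarrow>
     (\<forall>x. 0 \<le> r x) \<and>
     (\<forall>x. x \<notin> fixed_points \<phi> \<longrightarrow> 0 < r x \<and>
        (\<exists>\<theta> d. time_change \<phi> \<psi> x \<theta> \<and> (\<theta> has_real_derivative d) (at 0) \<and> r x = inverse d)) \<and>
     (\<forall>\<kappa>\<in>\<A>. Ck_on (k - 1) (snd \<kappa> ` (fst \<kappa> - fixed_points \<phi>)) (r \<circ> chart_inv \<kappa>))"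

definition invariant_measures ::
  "(real \<Rightarrow> 'a::topological_space \<Rightarrow> 'a) \<Rightarrow> 'a measure set" where
  "invariant_measures \<phi> =
     {\<mu>. prob_space \<mu> \<and> sets \<mu> = sets borel \<and> (\<forall>t. distr \<mu> borel (\<phi> t) = \<mu>)}"

text \<open>A fixed point counts as a (degenerate) periodic orbit.\<close>

definition non_atomic :: "(real \<Rightarrow> 'a \<Rightarrow> 'a) \<Rightarrow> 'a measure \<Rightarrow> bool" where
  "non_atomic \<phi> \<mu> \<longleftrightarrow>
     \<not> (\<exists>x. (\<exists>T>0. \<phi> T x = x) \<and> (AE y in \<mu>. y \<in> orbit \<phi> x))"

section \<open>Waiting times and recurrence rates\<close>

definition escape_time :: "(real \<Rightarrow> 'a \<Rightarrow> 'a) \<Rightarrow> 'a set \<Rightarrow> 'a \<Rightarrow> ereal" where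
  "escape_time \<phi> A y = Inf {ereal t | t. 0 < t \<and> \<phi> t y \<notin> A}"

definition entrance_time :: "(real \<Rightarrow> 'a \<Rightarrow> 'a) \<Rightarrow> 'a set \<Rightarrow> 'a \<Rightarrow> ereal" where
  "entrance_time \<phi> A y = Inf {ereal t | t. escape_time \<phi> A y < ereal t \<and> \<phi> t y \<in> A}"

definition ball_of :: "('a \<Rightarrow> 'a \<Rightarrow> ennreal) \<Rightarrow> 'a \<Rightarrow> real \<Rightarrow> 'a set" where
  "ball_of \<rho> x \<epsilon> = {z. \<rho> x z < ennreal \<epsilon>}"

definition ln_ereal :: "ereal \<Rightarrow> ereal" where
  "ln_ereal e = (if e \<le> 0 then - \<infinity> else if e = \<infinity> then \<infinity> else ereal (ln (real_of_ereal e)))"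

definition rate_quotient ::
  "('a \<Rightarrow> 'a \<Rightarrow> ennreal) \<Rightarrow> (real \<Rightarrow> 'a \<Rightarrow> 'a) \<Rightarrow> 'a \<Rightarrow> 'a \<Rightarrow> real \<Rightarrow> ereal" where
  "rate_quotient \<rho> \<phi> x y \<epsilon> =
     ln_ereal (entrance_time \<phi> (ball_of \<rho> x \<epsilon>) y) / ereal (- ln \<epsilon>)"

text \<open>
  Both rates are \<open>\<infinity>\<close> by convention when the entrance time is infinite for some arbitrarily small
  \<open>\<epsilon>\<close>. Large \<open>\<epsilon>\<close> must not count here: a ball containing the whole orbit of \<open>y\<close> is never left, so
  its entrance time is always infinite.
\<close>

definition no_entrance ::
  "('a \<Rightarrow> 'a \<Rightarrow> ennreal) \<Rightarrow> (real \<Rightarrow> 'a \<Rightarrow> 'a) \<Rightarrow> 'a \<Rightarrow> 'a \<Rightarrow> bool" where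
  "no_entrance \<rho> \<phi> x y \<longleftrightarrow>
     (\<exists>\<^sub>F \<epsilon> in at_right 0. entrance_time \<phi> (ball_of \<rho> x \<epsilon>) y = \<infinity>)"

definition lower_rate ::
  "('a \<Rightarrow> 'a \<Rightarrow> ennreal) \<Rightarrow> (real \<Rightarrow> 'a \<Rightarrow> 'a) \<Rightarrow> 'a \<Rightarrow> 'a \<Rightarrow> ereal" where
  "lower_rate \<rho> \<phi> x y =
     (if no_entrance \<rho> \<phi> x y then \<infinity> else Liminf (at_right 0) (rate_quotient \<rho> \<phi> x y))"

definition upper_rate ::
  "('a \<Rightarrow> 'a \<Rightarrow> ennreal) \<Rightarrow> (real \<Rightarrow> 'a \<Rightarrow> 'a) \<Rightarrow> 'a \<Rightarrow> 'a \<Rightarrow> ereal" where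
  "upper_rate \<rho> \<phi> x y =
     (if no_entrance \<rho> \<phi> x y then \<infinity> else Limsup (at_right 0) (rate_quotient \<rho> \<phi> x y))"

abbreviation lower_recurrence_rate ::
  "('a \<Rightarrow> 'a \<Rightarrow> ennreal) \<Rightarrow> (real \<Rightarrow> 'a \<Rightarrow> 'a) \<Rightarrow> 'a \<Rightarrow> ereal" where
  "lower_recurrence_rate \<rho> \<phi> x \<equiv> lower_rate \<rho> \<phi> x x"

abbreviation upper_recurrence_rate ::
  "('a \<Rightarrow> 'a \<Rightarrow> ennreal) \<Rightarrow> (real \<Rightarrow> 'a \<Rightarrow> 'a) \<Rightarrow> 'a \<Rightarrow> ereal" where
  "upper_recurrence_rate \<rho> \<phi> x \<equiv> upper_rate \<rho> \<phi> x x"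

end

theory Submission
  imports Defs
begin

text \<open>
  Along the orbit of a non-fixed point \<open>y\<close> the two flows differ by an increasing bijection \<open>\<sigma>\<close> of the
  time axis, with \<open>\<psi> (\<sigma> t) y = \<phi> t y\<close> and \<open>\<sigma>' t = r (\<phi> t y)\<close> (lemma \<open>new_time\<close>). Such a bijection
  carries the escape and entrance times of \<open>\<phi>\<close> into any set to those of \<open>\<psi>\<close>. If moreover
  \<open>c * t \<le> \<sigma> t \<le> C * t\<close> for all \<open>t > 0\<close> with positive constants depending on \<open>y\<close>, then the entrance
  times of the two flows differ by bounded factors, their logarithms by bounded amounts, and division
  by \<open>- ln \<epsilon>\<close> removes the difference in the limit (lemma \<open>rates_mono\<close>).
  
  It remains to find such linear bounds for almost every \<open>y\<close>. For small \<open>t\<close> they follow from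
  \<open>\<sigma>' 0 = r y > 0\<close>. For large \<open>t\<close> it suffices to look at integers \<open>n\<close>, where \<open>\<sigma> n\<close> is the Birkhoff sum
  under the time-one map of the new time spent in one unit of old time, \<open>\<integral>\<^sub>0\<^sup>1 r (\<phi> s y) ds\<close>. This function
  is integrable because \<open>r\<close> is. Two
  applications of the maximal ergodic inequality show that almost everywhere the averages are bounded,
  and bounded away from \<open>0\<close> where the function is positive (lemmas \<open>AE_birkhoff_sum_bounded\<close> and
  \<open>AE_birkhoff_sum_linear_growth\<close>).
  
  At a fixed point both flows stand still and the rates trivially agree.
\<close>

section \<open>Rates of flows with comparable entrance times\<close>

lemma ln_ereal_le_add:
  assumes "a \<le> ereal C * b" and "0 < C"
  shows "ln_ereal a \<le> ln_ereal b + ereal (ln C)"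
proof (cases b)
  case (real v)
  show ?thesis
  proof (cases "0 < v")
    case True
    show ?thesis
    proof (cases a)
      case (real u)
      have "ln u \<le> ln v + ln C" if "0 < u"
      proof -
        have "u \<le> C * v"
          using assms(1) real \<open>b = ereal v\<close> by simp
        then have "ln u \<le> ln (C * v)"
          using that by simp
        then show ?thesis
          using True assms(2) by (simp add: ln_mult)
      qed
      then show ?thesis
        using real \<open>b = ereal v\<close> True by (auto simp: ln_ereal_def)
    qed (use assms(1) \<open>b = ereal v\<close> in \<open>auto simp: ln_ereal_def\<close>)
  next
    case False
    then have "C * v \<le> 0"
      using assms(2) by (simp add: mult_le_0_iff)
    then have "ereal C * b \<le> 0"
      using real by simp
    with assms(1) have "a \<le> 0"
      by (rule order_trans)
    then show ?thesis
      by (simp add: ln_ereal_def)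
  qed
next
  case PInf
  then show ?thesis by (simp add: ln_ereal_def)
next
  case MInf
  then have "a \<le> 0"
    using assms by simp
  then show ?thesis by (simp add: ln_ereal_def)
qed

text \<open>
  A constant factor in the entrance times becomes an additive constant after taking logarithms, and
  the division by \<open>- ln \<epsilon>\<close> makes that constant vanish in the limit. The quotients themselves may be
  infinite, so the comparison is made up to an arbitrary \<open>\<delta>\<close> instead of through a difference.
\<close>

lemma rate_quotient_le_add:
  assumes "0 < C" and "0 < \<delta>"
    and "\<And>A. entrance_time \<psi> A y \<le> ereal C * entrance_time \<phi> A y"
  shows "\<forall>\<^sub>F \<epsilon> in at_right 0.
    rate_quotient \<rho> \<psi> x y \<epsilon> \<le> rate_quotient \<rho> \<phi> x y \<epsilon> + ereal \<delta>"
proof -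
  have "((\<lambda>\<epsilon>. ln C / - ln \<epsilon>) \<longlongrightarrow> 0) (at_right (0::real))"
    by (intro tendsto_divide_0[OF tendsto_const] filterlim_at_top_imp_at_infinity
        filterlim_uminus_at_bot[THEN iffD1] ln_at_0)
  then have "\<forall>\<^sub>F \<epsilon> in at_right 0. ln C / - ln \<epsilon> < \<delta>"
    using assms(2) by (rule order_tendstoD)
  moreover have "\<forall>\<^sub>F \<epsilon>::real in at_right 0. \<epsilon> \<in> {0<..<1}"
    by (rule eventually_at_right_real) simp
  ultimately show ?thesis
  proof eventually_elim
    case (elim \<epsilon>)
    define a where "a = ln_ereal (entrance_time \<phi> (ball_of \<rho> x \<epsilon>) y)"
    define d where "d = - ln \<epsilon>"
    have d: "0 < d"
      using elim(2) by (simp add: d_def)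
    have "rate_quotient \<rho> \<psi> x y \<epsilon> \<le> (a + ereal (ln C)) / ereal d"
      unfolding rate_quotient_def a_def d_def[symmetric]
      using d by (intro ereal_divide_right_mono ln_ereal_le_add assms) auto
    also have "\<dots> = a / ereal d + ereal (ln C / d)"
      using d by (cases a) (auto simp: add_divide_distrib)
    also have "\<dots> \<le> a / ereal d + ereal \<delta>"
      using elim(1) by (intro add_left_mono) (simp add: d_def)
    finally show ?case
      by (simp add: rate_quotient_def a_def d_def)
  qed
qed

text \<open>
  The bound is used once for each of the two flows, with the factors \<open>C\<close> and \<open>1 / c\<close>. It is assumed for
  all sets, so that one point \<open>y\<close> serves for every centre \<open>x\<close> and every distance.
\<close>

lemma rates_mono:
  assumes C: "0 < C"
    and le: "\<And>A. entrance_time \<psi> A y \<le> ereal C * entrance_time \<phi> A y"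
  shows "lower_rate \<rho> \<psi> x y \<le> lower_rate \<rho> \<phi> x y"
    and "upper_rate \<rho> \<psi> x y \<le> upper_rate \<rho> \<phi> x y"
proof -
  have inf: "entrance_time \<phi> A y = \<infinity>" if "entrance_time \<psi> A y = \<infinity>" for A
  proof (rule ccontr)
    assume "entrance_time \<phi> A y \<noteq> \<infinity>"
    then have "ereal C * entrance_time \<phi> A y \<noteq> \<infinity>"
      using C by (simp add: ereal_mult_eq_PInfty)
    then show False
      using le[of A] unfolding that ereal_infty_less_eq(1) by contradiction
  qed
  have no: "no_entrance \<rho> \<phi> x y" if "no_entrance \<rho> \<psi> x y"
    using that unfolding no_entrance_def by (rule frequently_elim1) (erule inf)
  have "Liminf (at_right 0) (rate_quotient \<rho> \<psi> x y) \<le> Liminf (at_right 0) (rate_quotient \<rho> \<phi> x y)"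
  proof (rule ereal_le_epsilon2)
    fix \<delta> :: real assume "0 < \<delta>"
    then have "Liminf (at_right 0) (rate_quotient \<rho> \<psi> x y)
        \<le> Liminf (at_right 0) (\<lambda>\<epsilon>. rate_quotient \<rho> \<phi> x y \<epsilon> + ereal \<delta>)"
      by (intro Liminf_mono rate_quotient_le_add[OF C _ le])
    also have "\<dots> = Liminf (at_right 0) (rate_quotient \<rho> \<phi> x y) + ereal \<delta>"
      by (rule Liminf_add_ereal_right) simp_all
    finally show "Liminf (at_right 0) (rate_quotient \<rho> \<psi> x y)
      \<le> Liminf (at_right 0) (rate_quotient \<rho> \<phi> x y) + ereal \<delta>" .
  qed
  then show "lower_rate \<rho> \<psi> x y \<le> lower_rate \<rho> \<phi> x y"
    using no by (simp add: lower_rate_def)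
  have "Limsup (at_right 0) (rate_quotient \<rho> \<psi> x y) \<le> Limsup (at_right 0) (rate_quotient \<rho> \<phi> x y)"
  proof (rule ereal_le_epsilon2)
    fix \<delta> :: real assume "0 < \<delta>"
    then have "Limsup (at_right 0) (rate_quotient \<rho> \<psi> x y)
        \<le> Limsup (at_right 0) (\<lambda>\<epsilon>. rate_quotient \<rho> \<phi> x y \<epsilon> + ereal \<delta>)"
      by (intro Limsup_mono rate_quotient_le_add[OF C _ le])
    also have "\<dots> = Limsup (at_right 0) (rate_quotient \<rho> \<phi> x y) + ereal \<delta>"
      by (rule Limsup_add_ereal_right) simp_all
    finally show "Limsup (at_right 0) (rate_quotient \<rho> \<psi> x y)
      \<le> Limsup (at_right 0) (rate_quotient \<rho> \<phi> x y) + ereal \<delta>" .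
  qed
  then show "upper_rate \<rho> \<psi> x y \<le> upper_rate \<rho> \<phi> x y"
    using no by (simp add: upper_rate_def)
qed

lemma escape_time_less_iff:
  "escape_time \<phi> A y < ereal t \<longleftrightarrow> (\<exists>s. 0 < s \<and> s < t \<and> \<phi> s y \<notin> A)"
  by (auto simp: escape_time_def Inf_less_iff)

lemma escape_time_nonneg: "0 \<le> escape_time \<phi> A y"
  by (auto simp: escape_time_def intro!: Inf_greatest)

text \<open>
  A time change \<open>\<sigma>\<close> along the orbit of \<open>y\<close> is an increasing bijection of the time axis. It carries
  the times outside \<open>A\<close> for \<open>\<phi>\<close> to those for \<open>\<psi>\<close> and preserves their order, hence it also carries
  the escape time to the escape time and the entrance time to the entrance time.
\<close>

context
  fixes \<phi> \<psi> :: "real \<Rightarrow> 'a \<Rightarrow> 'a" and \<sigma> :: "real \<Rightarrow> real" and y :: 'a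
  assumes \<sigma>: "\<sigma> 0 = 0" "strict_mono \<sigma>" "surj \<sigma>"
    and conj: "\<And>t. \<psi> (\<sigma> t) y = \<phi> t y"
begin

lemma escape_time_change_less_iff:
  "escape_time \<psi> A y < ereal (\<sigma> t) \<longleftrightarrow> escape_time \<phi> A y < ereal t"
proof -
  have "(\<exists>s. 0 < s \<and> s < \<sigma> t \<and> \<psi> s y \<notin> A) \<longleftrightarrow> (\<exists>u. 0 < \<sigma> u \<and> \<sigma> u < \<sigma> t \<and> \<psi> (\<sigma> u) y \<notin> A)"
    using \<sigma>(3) by (metis surjD)
  also have "\<dots> \<longleftrightarrow> (\<exists>u. 0 < u \<and> u < t \<and> \<phi> u y \<notin> A)"
    using strict_mono_less[OF \<sigma>(2)] \<sigma>(1) conj by metis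
  finally show ?thesis
    by (simp add: escape_time_less_iff)
qed

lemma entrance_time_change:
  "entrance_time \<psi> A y = Inf {ereal (\<sigma> t) | t. escape_time \<phi> A y < ereal t \<and> \<phi> t y \<in> A}"
proof -
  have "{ereal s | s. escape_time \<psi> A y < ereal s \<and> \<psi> s y \<in> A} =
      {ereal (\<sigma> t) | t. escape_time \<psi> A y < ereal (\<sigma> t) \<and> \<psi> (\<sigma> t) y \<in> A}"
    proof (intro subset_antisym subsetI)
    fix e assume "e \<in> {ereal s | s. escape_time \<psi> A y < ereal s \<and> \<psi> s y \<in> A}"
    then show "e \<in> {ereal (\<sigma> t) | t. escape_time \<psi> A y < ereal (\<sigma> t) \<and> \<psi> (\<sigma> t) y \<in> A}"
      using \<sigma>(3) by (smt (verit) mem_Collect_eq surjD)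
  qed auto
  then show ?thesis
    by (simp add: entrance_time_def escape_time_change_less_iff conj)
qed

lemma entrance_time_change_le:
  assumes C: "0 < C" and "\<And>t. 0 < t \<Longrightarrow> \<sigma> t \<le> C * t"
  shows "entrance_time \<psi> A y \<le> ereal C * entrance_time \<phi> A y"
proof -
  have "entrance_time \<psi> A y / ereal C \<le> entrance_time \<phi> A y"
    unfolding entrance_time_def[of \<phi>]
  proof (rule Inf_greatest, safe)
    fix t assume t: "escape_time \<phi> A y < ereal t" "\<phi> t y \<in> A"
    then have "0 < t"
      using escape_time_nonneg[of \<phi> A y] by (metis ereal_less(2) le_less_trans)
    have "entrance_time \<psi> A y \<le> ereal (\<sigma> t)"
      unfolding entrance_time_change using t by (auto intro!: Inf_lower)
    also have "\<dots> \<le> ereal t * ereal C"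
      using assms(2)[OF \<open>0 < t\<close>] by (simp add: mult.commute)
    finally show "entrance_time \<psi> A y / ereal C \<le> ereal t"
      using C by (simp add: ereal_divide_le_pos mult.commute)
  qed
  then show ?thesis
    using C by (simp add: ereal_divide_le_pos)
qed

lemma entrance_time_change_ge:
  assumes c: "0 < c" and "\<And>t. 0 < t \<Longrightarrow> c * t \<le> \<sigma> t"
  shows "entrance_time \<phi> A y \<le> ereal (1 / c) * entrance_time \<psi> A y"
proof -
  have "ereal c * entrance_time \<phi> A y \<le> entrance_time \<psi> A y"
    unfolding entrance_time_change
  proof (rule Inf_greatest, safe)
    fix t assume t: "escape_time \<phi> A y < ereal t" "\<phi> t y \<in> A"
    then have "0 < t"
      using escape_time_nonneg[of \<phi> A y] by (metis ereal_less(2) le_less_trans)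
    have "entrance_time \<phi> A y \<le> ereal t"
      unfolding entrance_time_def using t by (auto intro!: Inf_lower)
    then have "ereal c * entrance_time \<phi> A y \<le> ereal c * ereal t"
      using c by (intro ereal_mult_left_mono) auto
    also have "\<dots> \<le> ereal (\<sigma> t)"
      using assms(2)[OF \<open>0 < t\<close>] by simp
    finally show "ereal c * entrance_time \<phi> A y \<le> ereal (\<sigma> t)" .
  qed
  then show ?thesis
    using c by (cases "entrance_time \<phi> A y"; cases "entrance_time \<psi> A y")
      (auto simp: field_simps)
qed

end

section \<open>Time changes along an orbit\<close>

locale topological_flow =
  fixes \<phi> :: "real \<Rightarrow> 'a::t2_space \<Rightarrow> 'a"
  assumes flow_0: "\<phi> 0 x = x"
    and flow_add: "\<phi> (s + t) x = \<phi> s (\<phi> t x)"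
    and continuous_flow: "continuous_on UNIV (\<lambda>(t, x). \<phi> t x)"
begin

lemma flow_uminus: "\<phi> (- t) (\<phi> t x) = x"
  using flow_add[of "- t" t x] by (simp add: flow_0)

lemma continuous_orbit_map: "continuous_on UNIV (\<lambda>t. \<phi> t x)"
  by (rule continuous_on_compose2[OF continuous_flow, of UNIV "\<lambda>t. (t, x)", simplified])
    (auto intro!: continuous_intros)

lemma continuous_time_map: "continuous_on UNIV (\<phi> t)"
  by (rule continuous_on_compose2[OF continuous_flow, of UNIV "\<lambda>x. (t, x)", simplified])
    (auto intro!: continuous_intros)

lemma tendsto_orbit_map: "(a \<longlongrightarrow> t) F \<Longrightarrow> ((\<lambda>n. \<phi> (a n) x) \<longlongrightarrow> \<phi> t x) F"
  by (rule continuous_on_tendsto_compose[OF continuous_orbit_map]) auto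

text \<open>
  An orbit through a fixed point consists of that point only, because the flow can be run backwards.
\<close>

lemma fixed_point_flow_iff: "\<phi> t x \<in> fixed_points \<phi> \<longleftrightarrow> x \<in> fixed_points \<phi>"
proof
  assume fixed: "\<phi> t x \<in> fixed_points \<phi>"
  then have "\<phi> (- t) (\<phi> t x) = \<phi> t x"
    by (simp add: fixed_points_def)
  then have "\<phi> t x = x"
    by (simp add: flow_uminus)
  then show "x \<in> fixed_points \<phi>"
    using fixed by simp
next
  assume "x \<in> fixed_points \<phi>"
  then show "\<phi> t x \<in> fixed_points \<phi>"
    by (simp add: fixed_points_def)
qed

lemma period_int:
  assumes "\<phi> t x = x"
  shows "\<phi> (of_int k * t) x = x"
proof -
  have nat: "\<phi> (real n * t) x = x" for n
  proof (induction n)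
    case 0
    then show ?case by (simp add: flow_0)
  next
    case (Suc n)
    have "\<phi> (real (Suc n) * t) x = \<phi> t (\<phi> (real n * t) x)"
      by (simp add: flow_add[symmetric] algebra_simps)
    then show ?case
      using Suc assms by simp
  qed
  show ?thesis
  proof (cases "0 \<le> k")
    case True
    then show ?thesis
      using nat[of "nat k"] by simp
  next
    case False
    then have "real (nat (- k)) = - of_int k"
      by simp
    then show ?thesis
      using nat[of "nat (- k)"] flow_uminus[of "- (of_int k * t)" x] by simp
  qed
qed

text \<open>
  If \<open>x\<close> had nonzero periods \<open>p n\<close> tending to \<open>0\<close>, the integer multiples of these periods would be dense
  in the time axis, and by continuity every time would be a period.
\<close>

lemma not_fixed_imp_no_small_period:
  assumes "x \<notin> fixed_points \<phi>"
  obtains \<eta> where "0 < \<eta>" and "\<And>t. \<phi> t x = x \<Longrightarrow> \<bar>t\<bar> < \<eta> \<Longrightarrow> t = 0"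
proof -
  have "\<exists>\<eta>>0. \<forall>t. \<phi> t x = x \<longrightarrow> \<bar>t\<bar> < \<eta> \<longrightarrow> t = 0"
  proof (rule ccontr)
    assume neg: "\<not> ?thesis"
    have "\<exists>t. \<phi> t x = x \<and> \<bar>t\<bar> < inverse (real (Suc n)) \<and> t \<noteq> 0" for n
    proof -
      have "0 < inverse (real (Suc n))"
        by simp
      then show ?thesis
        using neg by blast
    qed
    then obtain p where p: "\<And>n. \<phi> (p n) x = x" "\<And>n. \<bar>p n\<bar> < inverse (real (Suc n))" "\<And>n. p n \<noteq> 0"
      by metis
    have "\<phi> t x = x" for t
    proof -
      \<comment> \<open>the multiple of the period \<open>p n\<close> just below \<open>t\<close>\<close>
      define a where "a n = of_int \<lfloor>t / p n\<rfloor> * p n" for n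
      have "\<bar>a n - t\<bar> \<le> inverse (real (Suc n))" for n
      proof -
        have "\<bar>of_int \<lfloor>t / p n\<rfloor> - t / p n\<bar> \<le> 1"
          by linarith
        then have "\<bar>of_int \<lfloor>t / p n\<rfloor> - t / p n\<bar> * \<bar>p n\<bar> \<le> 1 * \<bar>p n\<bar>"
          by (rule mult_right_mono) simp
        then have "\<bar>a n - t\<bar> \<le> \<bar>p n\<bar>"
          using p(3)[of n] by (simp only: abs_mult[symmetric] left_diff_distrib) (simp add: a_def)
        then show ?thesis
          using p(2)[of n] by simp
      qed
      then have "(\<lambda>n. a n - t) \<longlonglongrightarrow> 0"
        by (intro Lim_null_comparison[OF _ LIMSEQ_inverse_real_of_nat]) (simp add: eventually_sequentially)
      then have "a \<longlonglongrightarrow> t"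
        by (rule LIM_zero_cancel)
      then have "(\<lambda>n. \<phi> (a n) x) \<longlonglongrightarrow> \<phi> t x"
        by (rule tendsto_orbit_map)
      then have "(\<lambda>n. x) \<longlonglongrightarrow> \<phi> t x"
        unfolding a_def period_int[OF p(1)] .
      then show ?thesis
        using LIMSEQ_unique tendsto_const by metis
    qed
    then show False
      using assms by (simp add: fixed_points_def)
  qed
  then show ?thesis
    using that by blast
qed

end

text \<open>
  Of a time reparameterization with its associated function, this keeps what concerns single orbits.
\<close>

locale reparameterized_flow =
  original: topological_flow \<phi> + reparameterized: topological_flow \<psi>
  for \<phi> \<psi> :: "real \<Rightarrow> 'a::t2_space \<Rightarrow> 'a" +
  fixes r :: "'a \<Rightarrow> real"
  assumes same_orbit: "orbit \<psi> x = orbit \<phi> x"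
    and r_pos: "x \<notin> fixed_points \<phi> \<Longrightarrow> 0 < r x"
    and time_change_ex: "x \<notin> fixed_points \<phi> \<Longrightarrow>
      \<exists>\<theta>. time_change \<phi> \<psi> x \<theta> \<and> (\<theta> has_real_derivative inverse (r x)) (at 0)"
begin

lemma fixed_reparameterized_iff: "(\<forall>\<tau>. \<psi> \<tau> x = x) \<longleftrightarrow> (\<forall>t. \<phi> t x = x)"
proof -
  have "(\<forall>\<tau>. \<psi> \<tau> x = x) \<longleftrightarrow> orbit \<psi> x \<subseteq> {x}"
    by (auto simp: orbit_def)
  also have "\<dots> \<longleftrightarrow> (\<forall>t. \<phi> t x = x)"
    unfolding same_orbit by (auto simp: orbit_def)
  finally show ?thesis .
qed

text \<open>
  If the old time converges while the new time \<open>\<tau>\<close> escapes to infinity, then \<open>\<psi> \<tau> x\<close> converges to a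
  point of the orbit of \<open>x\<close>. A limit of an orbit along a filter invariant under time shifts is a fixed
  point. The filters \<open>F\<close> of interest are \<open>at_top\<close> and \<open>at_bot\<close>.
\<close>

lemma time_change_limit_imp_fixed:
  assumes \<theta>: "time_change \<phi> \<psi> x \<theta>" and lim: "(\<theta> \<longlongrightarrow> L) F"
    and F: "F \<noteq> bot" "\<And>s. filterlim (\<lambda>\<tau>. s + \<tau>) F F"
  shows "x \<in> fixed_points \<phi>"
proof -
  define z where "z = \<phi> L x"
  have "((\<lambda>\<tau>. \<phi> (\<theta> \<tau>) x) \<longlongrightarrow> z) F"
    unfolding z_def using lim by (rule original.tendsto_orbit_map)
  then have z: "((\<lambda>\<tau>. \<psi> \<tau> x) \<longlongrightarrow> z) F"
    using \<theta> by (simp add: time_change_def)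
  have "\<psi> s z = z" for s
  proof (rule tendsto_unique[OF F(1)])
    show "((\<lambda>\<tau>. \<psi> s (\<psi> \<tau> x)) \<longlongrightarrow> \<psi> s z) F"
      using z by (rule continuous_on_tendsto_compose[OF reparameterized.continuous_time_map]) auto
    show "((\<lambda>\<tau>. \<psi> s (\<psi> \<tau> x)) \<longlongrightarrow> z) F"
      using filterlim_compose[OF z F(2)[of s]] by (simp add: reparameterized.flow_add)
  qed
  then have "z \<in> fixed_points \<phi>"
    using fixed_reparameterized_iff[of z] by (simp add: fixed_points_def)
  then show ?thesis
    by (simp add: z_def original.fixed_point_flow_iff)
qed

text \<open>
  On a periodic orbit the equality of the orbits does not directly give surjectivity: a bounded
  interval of old times already covers the orbit. The reason that applies to all orbits is that a
  bounded monotone time change converges, which the preceding lemma excludes.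
\<close>

lemma time_change_surj:
  assumes \<theta>: "time_change \<phi> \<psi> x \<theta>" and x: "x \<notin> fixed_points \<phi>"
  shows "surj \<theta>"
proof -
  have mono: "strict_mono \<theta>" and cont: "continuous_on UNIV \<theta>"
    using \<theta> by (auto simp: time_change_def)
  have above: "\<exists>\<tau>. t \<le> \<theta> \<tau>" for t
  proof (rule ccontr)
    assume "\<nexists>\<tau>. t \<le> \<theta> \<tau>"
    then have "\<theta> \<tau> \<le> t" for \<tau>
      by (meson linear)
    then have bdd: "bdd_above (range \<theta>)"
      by (rule bdd_aboveI2)
    have "(\<theta> \<longlongrightarrow> Sup (range \<theta>)) at_top"
    proof (rule increasing_tendsto)
      show "\<forall>\<^sub>F \<tau> in at_top. \<theta> \<tau> \<le> Sup (range \<theta>)"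
        using bdd by (simp add: cSup_upper)
    next
      fix u assume "u < Sup (range \<theta>)"
      then obtain \<tau> where "u < \<theta> \<tau>"
        using less_cSupD[of "range \<theta>"] by auto
      then show "\<forall>\<^sub>F s in at_top. u < \<theta> s"
        by (intro eventually_mono[OF eventually_ge_at_top[of \<tau>]])
          (simp add: less_le_trans[OF _ strict_mono_less_eq[OF mono, THEN iffD2]])
    qed
    moreover have "filterlim (\<lambda>\<tau>. s + \<tau>) at_top at_top" for s :: real
      by (intro filterlim_tendsto_add_at_top[OF tendsto_const] filterlim_ident)
    ultimately show False
      using time_change_limit_imp_fixed[OF \<theta>, of _ at_top] x by simp
  qed
  have below: "\<exists>\<tau>. \<theta> \<tau> \<le> t" for t
  proof (rule ccontr)
    assume "\<nexists>\<tau>. \<theta> \<tau> \<le> t"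
    then have "t \<le> \<theta> \<tau>" for \<tau>
      by (meson linear)
    then have bdd: "bdd_below (range \<theta>)"
      by (rule bdd_belowI2)
    have "(\<theta> \<longlongrightarrow> Inf (range \<theta>)) at_bot"
    proof (rule decreasing_tendsto)
      show "\<forall>\<^sub>F \<tau> in at_bot. Inf (range \<theta>) \<le> \<theta> \<tau>"
        using bdd by (simp add: cInf_lower)
    next
      fix u assume "Inf (range \<theta>) < u"
      then obtain \<tau> where "\<theta> \<tau> < u"
        using cInf_lessD[of "range \<theta>"] by auto
      then show "\<forall>\<^sub>F s in at_bot. \<theta> s < u"
        by (intro eventually_mono[OF eventually_le_at_bot[of \<tau>]])
          (simp add: le_less_trans[OF strict_mono_less_eq[OF mono, THEN iffD2]])
    qed
    moreover have "filterlim (\<lambda>\<tau>. s + \<tau>) at_bot at_bot" for s :: real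
      unfolding filterlim_at_bot
    proof
      show "\<forall>\<^sub>F \<tau> in at_bot. s + \<tau> \<le> Z" for Z
        using eventually_le_at_bot[of "Z - s"] by eventually_elim simp
    qed
    ultimately show False
      using time_change_limit_imp_fixed[OF \<theta>, of _ at_bot] x by simp
  qed
  have "t \<in> range \<theta>" for t
  proof -
    obtain a b where "\<theta> a \<le> t" "t \<le> \<theta> b"
      using above below by blast
    moreover from this have "a \<le> b"
      using strict_mono_less_eq[OF mono, of a b] by simp
    ultimately show ?thesis
      using IVT'[of \<theta> a t b] continuous_on_subset[OF cont] by blast
  qed
  then show ?thesis
    by blast
qed

lemma time_change_shift:
  assumes \<theta>: "time_change \<phi> \<psi> x \<theta>"
  shows "time_change \<phi> \<psi> (\<psi> \<tau> x) (\<lambda>s. \<theta> (\<tau> + s) - \<theta> \<tau>)"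
proof -
  have cont: "continuous_on UNIV \<theta>" and \<psi>: "\<psi> s x = \<phi> (\<theta> s) x" for s
    using \<theta> by (auto simp: time_change_def)
  have "\<psi> s (\<psi> \<tau> x) = \<phi> (\<theta> (\<tau> + s) - \<theta> \<tau>) (\<psi> \<tau> x)" for s
    using original.flow_add[of "\<theta> (\<tau> + s) - \<theta> \<tau>" "\<theta> \<tau>" x]
      reparameterized.flow_add[of s \<tau> x]
    by (simp add: \<psi> add.commute)
  moreover have "continuous_on UNIV (\<lambda>s. \<theta> (\<tau> + s) - \<theta> \<tau>)"
    by (intro continuous_intros continuous_on_compose2[OF cont]) auto
  ultimately show ?thesis
    using \<theta> by (auto simp: time_change_def strict_mono_def)
qed

text \<open>
  Two time changes at the same new time differ by a period of \<open>x\<close>; near time \<open>0\<close> the difference is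
  too small for a nonzero period. This transfers derivatives at \<open>0\<close> from one time change to another.
\<close>

lemma time_change_locally_unique:
  assumes x: "x \<notin> fixed_points \<phi>"
    and \<theta>: "time_change \<phi> \<psi> x \<theta>" "time_change \<phi> \<psi> x \<theta>'"
  shows "\<forall>\<^sub>F s in nhds 0. \<theta> s = \<theta>' s"
proof -
  obtain \<eta> where \<eta>: "0 < \<eta>" "\<And>t. \<phi> t x = x \<Longrightarrow> \<bar>t\<bar> < \<eta> \<Longrightarrow> t = 0"
    using original.not_fixed_imp_no_small_period[OF x] by blast
  have "isCont (\<lambda>s. \<theta> s - \<theta>' s) 0"
    using \<theta> by (intro isCont_diff) (auto simp: time_change_def continuous_on_eq_continuous_at)
  then have "((\<lambda>s. \<theta> s - \<theta>' s) \<longlongrightarrow> \<theta> 0 - \<theta>' 0) (nhds 0)"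
    unfolding isCont_def using tendsto_at_iff_tendsto_nhds[of "\<lambda>s. \<theta> s - \<theta>' s" 0] by simp
  moreover have "\<theta> 0 - \<theta>' 0 = 0"
    using \<theta> by (simp add: time_change_def)
  ultimately have "((\<lambda>s. \<theta> s - \<theta>' s) \<longlongrightarrow> 0) (nhds 0)"
    by simp
  then have "\<forall>\<^sub>F s in nhds 0. \<bar>\<theta> s - \<theta>' s\<bar> < \<eta>"
    using \<eta>(1) by (auto simp: tendsto_iff dist_real_def)
  then show ?thesis
  proof eventually_elim
    case (elim s)
    have "\<phi> (\<theta> s - \<theta>' s) x = \<phi> (- \<theta>' s) (\<phi> (\<theta> s) x)"
      using original.flow_add[of "- \<theta>' s" "\<theta> s" x] by simp
    also have "\<dots> = x"
      using \<theta> original.flow_uminus by (metis time_change_def)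
    finally show ?case
      using \<eta>(2) elim by fastforce
  qed
qed

text \<open>
  The associated function gives the derivative of a time change at time \<open>0\<close> only. The flow property
  turns the behaviour at time \<open>\<tau>\<close> into the behaviour at time \<open>0\<close> of a time change at \<open>\<psi> \<tau> x\<close>.
\<close>

lemma time_change_has_derivative:
  assumes x: "x \<notin> fixed_points \<phi>" and \<theta>: "time_change \<phi> \<psi> x \<theta>"
  shows "(\<theta> has_real_derivative inverse (r (\<psi> \<tau> x))) (at \<tau>)"
proof -
  have z: "\<psi> \<tau> x \<notin> fixed_points \<phi>"
    using x \<theta> by (simp add: time_change_def original.fixed_point_flow_iff)
  then obtain \<theta>' where \<theta>': "time_change \<phi> \<psi> (\<psi> \<tau> x) \<theta>'"
      "(\<theta>' has_real_derivative inverse (r (\<psi> \<tau> x))) (at 0)"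
    using time_change_ex by blast
  have "\<forall>\<^sub>F s in nhds 0. \<theta>' s = \<theta> (\<tau> + s) - \<theta> \<tau>"
    using z \<theta>'(1) time_change_shift[OF \<theta>] by (rule time_change_locally_unique)
  then have "((\<lambda>s. \<theta> (\<tau> + s) - \<theta> \<tau>) has_real_derivative inverse (r (\<psi> \<tau> x))) (at 0)"
    by (rule DERIV_cong_ev[OF refl _ refl, THEN iffD1]) (rule \<theta>'(2))
  then have "((\<lambda>s. \<theta> (\<tau> + s) - \<theta> \<tau> + \<theta> \<tau>) has_real_derivative inverse (r (\<psi> \<tau> x)) + 0) (at 0)"
    by (intro DERIV_add DERIV_const)
  then show ?thesis
    using DERIV_shift[of \<theta> _ 0 \<tau>] by (simp add: add.commute)
qed

text \<open>
  The function \<open>\<sigma>\<close> is the elapsed new time as a function of the old time. Its derivative is the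
  differential form of \<open>d\<tau> = r dt\<close>.
\<close>

lemma new_time:
  assumes x: "x \<notin> fixed_points \<phi>"
  obtains \<sigma> where "\<sigma> 0 = 0" "strict_mono \<sigma>" "surj \<sigma>"
    and "\<And>t. (\<sigma> has_real_derivative r (\<phi> t x)) (at t)"
    and "\<And>t. \<psi> (\<sigma> t) x = \<phi> t x"
proof -
  obtain \<theta> where \<theta>: "time_change \<phi> \<psi> x \<theta>"
    using time_change_ex[OF x] by blast
  then have \<theta>0: "\<theta> 0 = 0" and mono: "strict_mono \<theta>" and \<psi>: "\<psi> \<tau> x = \<phi> (\<theta> \<tau>) x" for \<tau>
    by (auto simp: time_change_def)
  have surj: "surj \<theta>" and inj: "inj \<theta>"
    using time_change_surj[OF \<theta> x] strict_mono_imp_inj_on[OF mono] by auto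
  define \<sigma> where "\<sigma> = inv \<theta>"
  have \<theta>\<sigma>: "\<theta> (\<sigma> t) = t" and \<sigma>\<theta>: "\<sigma> (\<theta> t) = t" for t
    using surj inj by (simp_all add: \<sigma>_def surj_f_inv_f inv_f_f)
  have \<sigma>_less: "\<sigma> s < \<sigma> t \<longleftrightarrow> s < t" for s t
    using strict_mono_less[OF mono, of "\<sigma> s" "\<sigma> t"] by (simp add: \<theta>\<sigma>)
  have surj_\<sigma>: "surj \<sigma>"
    using \<sigma>\<theta> by (metis surjI)
  have cont: "continuous_on UNIV \<sigma>"
    using surj_\<sigma> \<sigma>_less by (intro continuous_onI_mono) (auto simp: not_less[symmetric])
  show ?thesis
  proof (rule that)
    show "\<sigma> 0 = 0"
      using \<sigma>\<theta>[of 0] by (simp add: \<theta>0)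
    show "strict_mono \<sigma>"
      using \<sigma>_less by (auto simp: strict_mono_def)
    show "surj \<sigma>"
      by (rule surj_\<sigma>)
    show conj: "\<psi> (\<sigma> t) x = \<phi> t x" for t
      by (simp add: \<psi> \<theta>\<sigma>)
    show "(\<sigma> has_real_derivative r (\<phi> t x)) (at t)" for t
    proof -
      have "0 < r (\<phi> t x)"
        using x by (intro r_pos) (simp add: original.fixed_point_flow_iff)
      moreover have "(\<theta> has_real_derivative inverse (r (\<phi> t x))) (at (\<sigma> t))"
        using time_change_has_derivative[OF x \<theta>, of "\<sigma> t"] by (simp add: conj)
      ultimately have "(\<sigma> has_real_derivative inverse (inverse (r (\<phi> t x)))) (at t)"
        using cont
        by (intro DERIV_inverse_function[where f = \<theta> and g = \<sigma> and a = "t - 1" and b = "t + 1"])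
          (auto simp: \<theta>\<sigma> continuous_on_eq_continuous_at)
      then show ?thesis
        by simp
    qed
  qed
qed

end

section \<open>The maximal ergodic inequality\<close>

definition birkhoff_sum :: "('a \<Rightarrow> 'a) \<Rightarrow> ('a \<Rightarrow> real) \<Rightarrow> nat \<Rightarrow> 'a \<Rightarrow> real" where
  "birkhoff_sum T h n x = (\<Sum>i<n. h ((T ^^ i) x))"

text \<open>
  The maximum of the first \<open>n + 1\<close> Birkhoff sums, including the empty sum. The recursion on the
  orbit's starting point is the identity from which Garsia's proof of the maximal ergodic inequality
  follows.
\<close>

primrec max_birkhoff_sum :: "('a \<Rightarrow> 'a) \<Rightarrow> ('a \<Rightarrow> real) \<Rightarrow> nat \<Rightarrow> 'a \<Rightarrow> real" where
  "max_birkhoff_sum T h 0 x = 0"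
| "max_birkhoff_sum T h (Suc n) x = max 0 (h x + max_birkhoff_sum T h n (T x))"

lemma birkhoff_sum_Suc: "birkhoff_sum T h (Suc n) x = h x + birkhoff_sum T h n (T x)"
  unfolding birkhoff_sum_def by (subst sum.lessThan_Suc_shift) (simp add: funpow_swap1)

lemma birkhoff_sum_diff:
  "birkhoff_sum T (\<lambda>x. h x - k x) n x
    = birkhoff_sum T h n x - birkhoff_sum T k n x"
  by (simp add: birkhoff_sum_def sum_subtractf)

lemma birkhoff_sum_const: "birkhoff_sum T (\<lambda>x. c) n x = c * real n"
  by (simp add: birkhoff_sum_def)

lemma birkhoff_sum_le_max: "birkhoff_sum T h n x \<le> max_birkhoff_sum T h n x"
proof (induction n arbitrary: x)
  case 0
  then show ?case by (simp add: birkhoff_sum_def)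
next
  case (Suc n)
  have "birkhoff_sum T h n (T x) \<le> max_birkhoff_sum T h n (T x)"
    by (rule Suc)
  then show ?case
    by (simp add: birkhoff_sum_Suc le_max_iff_disj)
qed

lemma max_birkhoff_sum_attained: "\<exists>k. max_birkhoff_sum T h n x = birkhoff_sum T h k x"
proof (induction n arbitrary: x)
  case 0
  have "max_birkhoff_sum T h 0 x = birkhoff_sum T h 0 x"
    by (simp add: birkhoff_sum_def)
  then show ?case ..
next
  case (Suc n)
  obtain k where k: "max_birkhoff_sum T h n (T x) = birkhoff_sum T h k (T x)"
    using Suc by blast
  show ?case
  proof (cases "0 \<le> h x + max_birkhoff_sum T h n (T x)")
    case True
    then have "max_birkhoff_sum T h (Suc n) x = birkhoff_sum T h (Suc k) x"
      by (simp add: birkhoff_sum_Suc k)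
    then show ?thesis ..
  next
    case False
    then have "max_birkhoff_sum T h (Suc n) x = birkhoff_sum T h 0 x"
      by (simp add: birkhoff_sum_def)
    then show ?thesis ..
  qed
qed

lemma max_birkhoff_sum_nonneg: "0 \<le> max_birkhoff_sum T h n x"
  by (cases n) simp_all

lemma max_birkhoff_sum_mono_Suc: "max_birkhoff_sum T h n x \<le> max_birkhoff_sum T h (Suc n) x"
proof (induction n arbitrary: x)
  case 0
  then show ?case by simp
next
  case (Suc n)
  have "h x + max_birkhoff_sum T h n (T x) \<le> h x + max_birkhoff_sum T h (Suc n) (T x)"
    using Suc[of "T x"] by simp
  then have "max 0 (h x + max_birkhoff_sum T h n (T x)) \<le> max 0 (h x + max_birkhoff_sum T h (Suc n) (T x))"
    by (rule max.mono[OF order_refl])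
  then show ?case
    by (simp only: max_birkhoff_sum.simps(2))
qed

lemma birkhoff_sum_pos_iff:
  "(\<exists>n. 0 < birkhoff_sum T h n x) \<longleftrightarrow> (\<exists>n. 0 < max_birkhoff_sum T h n x)"
  using birkhoff_sum_le_max max_birkhoff_sum_attained by (metis less_le_trans)

text \<open>
  Where the maximum is positive it equals \<open>h\<close> plus an earlier maximum at \<open>T x\<close>, which is at most the
  present maximum at \<open>T x\<close>. Elsewhere it is \<open>0\<close>, and the maximum at \<open>T x\<close> is nonnegative.
\<close>

lemma max_birkhoff_sum_drop:
  "max_birkhoff_sum T h (Suc n) x - max_birkhoff_sum T h (Suc n) (T x)
    \<le> (if 0 < max_birkhoff_sum T h (Suc n) x then h x else 0)"
  using max_birkhoff_sum_mono_Suc[of T h n "T x"] max_birkhoff_sum_nonneg[of T h "Suc n" "T x"]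
  by (auto simp: max_def split: if_splits)

context prob_space
begin

context
  fixes T :: "'a \<Rightarrow> 'a"
  assumes T: "T \<in> measurable M M" and invariant: "distr M M T = M"
begin

lemma funpow_measurable [measurable]: "T ^^ n \<in> measurable M M"
  using T by (induction n) (auto intro: measurable_comp)

lemma birkhoff_sum_measurable [measurable (raw)]:
  assumes [measurable]: "h \<in> borel_measurable M"
  shows "birkhoff_sum T h n \<in> borel_measurable M"
  unfolding birkhoff_sum_def[abs_def] by measurable

lemma integrable_max_birkhoff_sum:
  assumes "integrable M h"
  shows "integrable M (max_birkhoff_sum T h n)"
proof (induction n)
  case 0
  have "max_birkhoff_sum T h 0 = (\<lambda>x. 0)"
    by (simp add: fun_eq_iff)
  then show ?case
    by simp
next
  case (Suc n)
  have "integrable M (\<lambda>x. max_birkhoff_sum T h n (T x))"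
    by (rule integrable_distr[OF T]) (simp add: invariant Suc)
  then have "integrable M (\<lambda>x. max 0 (h x + max_birkhoff_sum T h n (T x)))"
    using assms by simp
  moreover have "max_birkhoff_sum T h (Suc n) = (\<lambda>x. max 0 (h x + max_birkhoff_sum T h n (T x)))"
    by (simp add: fun_eq_iff)
  ultimately show ?case
    by (simp only:)
qed

text \<open>
  By invariance the left-hand side in \<open>max_birkhoff_sum_drop\<close> has integral \<open>0\<close>, so \<open>h\<close> has
  nonnegative integral over the set where the maximum of the first sums is positive. These sets
  increase to the set where some Birkhoff sum is positive, and dominated convergence applies.
\<close>

lemma maximal_ergodic_inequality:
  assumes h: "integrable M h"
  shows "0 \<le> (\<integral>x. (if \<exists>n. 0 < birkhoff_sum T h n x then h x else 0) \<partial>M)"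
proof -
  have [measurable]: "h \<in> borel_measurable M"
    using h by auto
  have [measurable]: "max_birkhoff_sum T h n \<in> borel_measurable M" for n
    using integrable_max_birkhoff_sum[OF h] by blast
  define u where "u n x = (if 0 < max_birkhoff_sum T h (Suc n) x then h x else 0)" for n x
  have [measurable]: "u n \<in> borel_measurable M" for n
    unfolding u_def by measurable
  have u_int: "integrable M (u n)" for n
    by (rule Bochner_Integration.integrable_bound[OF h]) (auto simp: u_def)
  have pos: "0 \<le> (\<integral>x. u n x \<partial>M)" for n
  proof -
    let ?m = "max_birkhoff_sum T h (Suc n)"
    have m: "integrable M ?m" and mT: "integrable M (\<lambda>x. ?m (T x))"
      using integrable_max_birkhoff_sum[OF h, of "Suc n"] integrable_distr[OF T, of ?m]
      by (simp_all only: invariant)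
    have "(\<integral>x. ?m (T x) \<partial>M) = (\<integral>x. ?m x \<partial>distr M M T)"
      by (rule integral_distr[OF T, symmetric]) measurable
    then have "(\<integral>x. ?m x - ?m (T x) \<partial>M) = 0"
      using Bochner_Integration.integral_diff[OF m mT] by (simp only: invariant)
    moreover have "(\<integral>x. ?m x - ?m (T x) \<partial>M) \<le> (\<integral>x. u n x \<partial>M)"
      by (rule integral_mono[OF Bochner_Integration.integrable_diff[OF m mT] u_int])
        (simp only: u_def max_birkhoff_sum_drop)
    ultimately show ?thesis
      by simp
  qed
  have "(\<lambda>n. \<integral>x. u n x \<partial>M) \<longlonglongrightarrow> (\<integral>x. (if \<exists>n. 0 < birkhoff_sum T h n x then h x else 0) \<partial>M)"
  proof (rule integral_dominated_convergence)
    show "integrable M (\<lambda>x. \<bar>h x\<bar>)"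
      using h by simp
    show "AE x in M. (\<lambda>n. u n x) \<longlonglongrightarrow> (if \<exists>n. 0 < birkhoff_sum T h n x then h x else 0)"
    proof (rule AE_I2)
      fix x
      show "(\<lambda>n. u n x) \<longlonglongrightarrow> (if \<exists>n. 0 < birkhoff_sum T h n x then h x else 0)"
      proof (cases "\<exists>n. 0 < birkhoff_sum T h n x")
        case True
        then obtain N where N: "0 < max_birkhoff_sum T h N x"
          by (auto simp: birkhoff_sum_pos_iff)
        have "u n x = h x" if "N \<le> n" for n
        proof -
          have "max_birkhoff_sum T h N x \<le> max_birkhoff_sum T h (Suc n) x"
            by (rule lift_Suc_mono_le[where f = "\<lambda>n. max_birkhoff_sum T h n x"])
              (use that in \<open>auto intro: max_birkhoff_sum_mono_Suc simp del: max_birkhoff_sum.simps\<close>)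
          then show ?thesis
            using N by (simp add: u_def del: max_birkhoff_sum.simps)
        qed
        then show ?thesis
          using True by (auto intro!: tendsto_eventually eventually_sequentiallyI[of N])
      next
        case False
        then have "\<not> 0 < max_birkhoff_sum T h n x" for n
          by (simp add: birkhoff_sum_pos_iff)
        then have "u n x = 0" for n
          by (simp only: u_def if_False)
        then show ?thesis
          using False by simp
      qed
    qed
    show "AE x in M. norm (u n x) \<le> \<bar>h x\<bar>" for n
      by (simp add: u_def)
  qed measurable
  then show ?thesis
    by (rule LIMSEQ_le_const) (use pos in blast)
qed

text \<open>
  The maximal inequality for \<open>h - K\<close> bounds the measure of the set \<open>E K\<close> on which some average
  exceeds \<open>K\<close> by \<open>expectation h / K\<close>. Points with unbounded averages lie in every \<open>E K\<close>.
\<close>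

lemma AE_birkhoff_sum_bounded:
  assumes h: "integrable M h" and nonneg: "\<And>x. 0 \<le> h x"
  shows "AE x in M. \<exists>K. \<forall>n. birkhoff_sum T h n x \<le> K * real n"
proof -
  have [measurable]: "h \<in> borel_measurable M"
    using h by auto
  define E where "E K = {x \<in> space M. \<exists>n. K * real n < birkhoff_sum T h n x}" for K :: real
  have [measurable]: "E K \<in> sets M" for K
    unfolding E_def by measurable
  have E_iff: "(\<exists>n. 0 < birkhoff_sum T (\<lambda>x. h x - K) n x) \<longleftrightarrow> x \<in> E K" if "x \<in> space M" for x K
    using that by (simp add: E_def birkhoff_sum_diff birkhoff_sum_const)
  have weak: "K * prob (E K) \<le> expectation h" for K
  proof -
    have hE: "integrable M (\<lambda>x. h x * indicator (E K) x)"
      by (rule integrable_real_mult_indicator[OF _ h]) measurable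
    have "0 \<le> (\<integral>x. (if \<exists>n. 0 < birkhoff_sum T (\<lambda>x. h x - K) n x then h x - K else 0) \<partial>M)"
      using h by (intro maximal_ergodic_inequality) simp
    also have "\<dots> = (\<integral>x. h x * indicator (E K) x - K * indicator (E K) x \<partial>M)"
      by (rule Bochner_Integration.integral_cong) (auto simp: E_iff)
    also have "\<dots> = (\<integral>x. h x * indicator (E K) x \<partial>M) - K * prob (E K)"
      using hE by (subst Bochner_Integration.integral_diff)
        (simp_all add: integrable_real_indicator emeasure_eq_measure)
    finally have "K * prob (E K) \<le> (\<integral>x. h x * indicator (E K) x \<partial>M)"
      by simp
    also have "\<dots> \<le> expectation h"
      using nonneg by (intro integral_mono[OF hE h]) (auto simp: indicator_def)
    finally show ?thesis .
  qed
  define N where "N = (\<Inter>k. E (real k))"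
  have N: "N \<in> sets M"
    unfolding N_def by (intro sets.countable_INT') auto
  have "real k * prob N \<le> expectation h" for k
  proof -
    have "prob N \<le> prob (E (real k))"
      by (rule finite_measure_mono) (auto simp: N_def)
    then have "real k * prob N \<le> real k * prob (E (real k))"
      by (intro mult_left_mono) auto
    then show ?thesis
      using weak[of "real k"] by simp
  qed
  then have "\<not> 0 < prob N"
    using reals_Archimedean3[of "prob N"] by (meson not_le)
  then have "N \<in> null_sets M"
    using N by (simp add: null_sets_def emeasure_eq_measure zero_less_measure_iff)
  then have "AE x in M. x \<notin> N"
    by (rule AE_not_in)
  then show ?thesis
    using AE_space
  proof eventually_elim
    case (elim x)
    then obtain k where "x \<notin> E (real k)"
      by (auto simp: N_def)
    then have "\<forall>n. birkhoff_sum T h n x \<le> real k * real n"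
      using elim by (simp add: E_def not_less)
    then show ?case ..
  qed
qed

text \<open>
  The maximal inequality for \<open>\<delta> - h\<close> shows that \<open>h\<close> has integral at most \<open>\<delta>\<close> over the set \<open>E \<delta>\<close> on
  which some average falls below \<open>\<delta>\<close>. So \<open>h\<close> has integral \<open>0\<close> over the intersection of these sets,
  and hence vanishes almost everywhere there.
\<close>

lemma AE_birkhoff_sum_linear_growth:
  assumes h: "integrable M h" and nonneg: "\<And>x. 0 \<le> h x"
  shows "AE x in M. 0 < h x \<longrightarrow> (\<exists>\<delta>>0. \<forall>n. \<delta> * real n \<le> birkhoff_sum T h n x)"
proof -
  have [measurable]: "h \<in> borel_measurable M"
    using h by auto
  define E where "E \<delta> = {x \<in> space M. \<exists>n. birkhoff_sum T h n x < \<delta> * real n}" for \<delta> :: real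
  have [measurable]: "E \<delta> \<in> sets M" for \<delta>
    unfolding E_def by measurable
  have E_iff: "(\<exists>n. 0 < birkhoff_sum T (\<lambda>x. \<delta> - h x) n x) \<longleftrightarrow> x \<in> E \<delta>" if "x \<in> space M" for x \<delta>
    using that by (simp add: E_def birkhoff_sum_diff birkhoff_sum_const)
  have hE: "integrable M (\<lambda>x. h x * indicator A x)" if "A \<in> sets M" for A
    using that h by (rule integrable_real_mult_indicator)
  have weak: "(\<integral>x. h x * indicator (E \<delta>) x \<partial>M) \<le> \<delta>" if "0 < \<delta>" for \<delta>
  proof -
    have "0 \<le> (\<integral>x. (if \<exists>n. 0 < birkhoff_sum T (\<lambda>x. \<delta> - h x) n x then \<delta> - h x else 0) \<partial>M)"
      using h by (intro maximal_ergodic_inequality) simp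
    also have "\<dots> = (\<integral>x. \<delta> * indicator (E \<delta>) x - h x * indicator (E \<delta>) x \<partial>M)"
      by (rule Bochner_Integration.integral_cong) (auto simp: E_iff)
    also have "\<dots> = \<delta> * prob (E \<delta>) - (\<integral>x. h x * indicator (E \<delta>) x \<partial>M)"
      using hE by (subst Bochner_Integration.integral_diff)
        (simp_all add: integrable_real_indicator emeasure_eq_measure)
    finally have "(\<integral>x. h x * indicator (E \<delta>) x \<partial>M) \<le> \<delta> * prob (E \<delta>)"
      by simp
    also have "\<dots> \<le> \<delta>"
      using that by (simp add: mult_left_le)
    finally show ?thesis .
  qed
  define N where "N = (\<Inter>k. E (inverse (real (Suc k))))"
  have N [measurable]: "N \<in> sets M"
    unfolding N_def by (intro sets.countable_INT') auto
  have "(\<integral>x. h x * indicator N x \<partial>M) \<le> inverse (real (Suc k))" for k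
  proof -
    have "(\<integral>x. h x * indicator N x \<partial>M)
        \<le> (\<integral>x. h x * indicator (E (inverse (real (Suc k)))) x \<partial>M)"
      using nonneg by (intro integral_mono hE) (auto simp: N_def indicator_def)
    also have "\<dots> \<le> inverse (real (Suc k))"
      by (rule weak) simp
    finally show ?thesis .
  qed
  then have "(\<integral>x. h x * indicator N x \<partial>M) \<le> 0"
    by (intro LIMSEQ_le_const[OF LIMSEQ_inverse_real_of_nat]) blast
  then have "(\<integral>x. h x * indicator N x \<partial>M) = 0"
    using nonneg by (intro antisym integral_nonneg) auto
  then have "AE x in M. h x * indicator N x = 0"
    using nonneg by (subst (asm) integral_nonneg_eq_0_iff_AE[OF hE]) auto
  then show ?thesis
    using AE_space
  proof eventually_elim
    case (elim x)
    show ?case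
    proof
      assume "0 < h x"
      then have "x \<notin> N"
        using elim by (auto simp: indicator_def)
      then obtain k where "x \<notin> E (inverse (real (Suc k)))"
        by (auto simp: N_def)
      then have "\<forall>n. inverse (real (Suc k)) * real n \<le> birkhoff_sum T h n x"
        using elim by (simp add: E_def not_less)
      moreover have "0 < inverse (real (Suc k))"
        by simp
      ultimately show "\<exists>\<delta>>0. \<forall>n. \<delta> * real n \<le> birkhoff_sum T h n x"
        by blast
    qed
  qed
qed

end

end

section \<open>Linear growth of the new time\<close>

text \<open>
  Monotonicity interpolates the bounds between the integer times. It cannot control the quotient
  \<open>\<sigma> t / t\<close> near \<open>0\<close>, where the positive derivative does. Arbitrarily small times matter because the
  entrance times need not stay away from \<open>0\<close> as the ball shrinks.
\<close>

lemma linear_bounds_from_integer_times: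
  fixes \<sigma> :: "real \<Rightarrow> real"
  assumes \<sigma>: "\<sigma> 0 = 0" "strict_mono \<sigma>"
    and d: "(\<sigma> has_real_derivative d) (at 0)" "0 < d"
    and \<delta>: "0 < \<delta>" "\<And>n. \<delta> * real n \<le> \<sigma> (real n)"
    and K: "\<And>n. \<sigma> (real n) \<le> K * real n"
  obtains c C where "0 < c" "0 < C" "\<And>t. 0 < t \<Longrightarrow> c * t \<le> \<sigma> t" "\<And>t. 0 < t \<Longrightarrow> \<sigma> t \<le> C * t"
proof -
  have mono: "\<sigma> s \<le> \<sigma> t" if "s \<le> t" for s t
    using that strict_mono_less_eq[OF \<sigma>(2)] by simp
  have "((\<lambda>t. \<sigma> t / t) \<longlongrightarrow> d) (at 0)"
    using d(1) \<sigma>(1) by (simp add: has_field_derivative_iff)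
  then have "\<forall>\<^sub>F t in at 0. d / 2 < \<sigma> t / t \<and> \<sigma> t / t < 2 * d"
    using d(2) by (intro eventually_conj order_tendstoD) auto
  then obtain h where h: "0 < h"
      "\<And>t. t \<noteq> 0 \<Longrightarrow> \<bar>t\<bar> < h \<Longrightarrow> d / 2 < \<sigma> t / t \<and> \<sigma> t / t < 2 * d"
    by (auto simp: eventually_at dist_real_def)
  have \<sigma>h: "0 < \<sigma> h"
    using strict_mono_less[OF \<sigma>(2), of 0 h] h(1) \<sigma>(1) by simp
  have K0: "0 < K"
    using K[of 1] \<delta>(2)[of 1] \<delta>(1) by simp
  \<comment> \<open>the three lower bounds hold for \<open>t < h\<close>, for \<open>h \<le> t < 1\<close> and for \<open>t \<ge> 1\<close>\<close>
  define c where "c = min (d / 2) (min (\<sigma> h) (\<delta> / 2))"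
  \<comment> \<open>the second bound comes from \<open>t + 1 \<le> (1 + 1 / h) * t\<close> for \<open>t \<ge> h\<close>\<close>
  define C where "C = max (2 * d) (K * (1 + 1 / h))"
  show ?thesis
  proof (rule that)
    show "0 < c" "0 < C"
      using d(2) \<sigma>h \<delta>(1) by (auto simp: c_def C_def)
    fix t :: real assume t: "0 < t"
    show "c * t \<le> \<sigma> t"
    proof -
      consider "t < h" | "h \<le> t" "t < 1" | "1 \<le> t"
        by linarith
      then have "d / 2 * t \<le> \<sigma> t \<or> \<sigma> h * t \<le> \<sigma> t \<or> \<delta> / 2 * t \<le> \<sigma> t"
      proof cases
        case 1
        then have "d / 2 < \<sigma> t / t"
          using h(2)[of t] t by simp
        then show ?thesis
          using t by (simp add: field_simps)
      next
        case 2
        have "\<sigma> h * t \<le> \<sigma> h * 1"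
          using 2 \<sigma>h by (intro mult_left_mono) auto
        then show ?thesis
          using mono[OF 2(1)] by simp
      next
        case 3
        define n where "n = nat \<lfloor>t\<rfloor>"
        have "real n = of_int \<lfloor>t\<rfloor>" "1 \<le> \<lfloor>t\<rfloor>"
          using 3 by (simp_all add: n_def)
        then have n: "t / 2 \<le> real n" "real n \<le> t"
          by linarith+
        have "\<delta> / 2 * t \<le> \<delta> * real n"
          using n(1) \<delta>(1) by (simp add: field_simps)
        then show ?thesis
          using \<delta>(2)[of n] mono[OF n(2)] by simp
      qed
      moreover have "c * t \<le> d / 2 * t" "c * t \<le> \<sigma> h * t" "c * t \<le> \<delta> / 2 * t"
        using t by (auto simp: c_def intro!: mult_right_mono)
      ultimately show ?thesis
        by linarith
    qed
    show "\<sigma> t \<le> C * t"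
    proof (cases "t < h")
      case True
      then have "\<sigma> t / t < 2 * d"
        using h(2)[of t] t by simp
      then have "\<sigma> t \<le> 2 * d * t"
        using t by (simp add: field_simps)
      moreover have "2 * d * t \<le> C * t"
        using t by (intro mult_right_mono) (auto simp: C_def)
      ultimately show ?thesis
        by simp
    next
      case False
      define n where "n = nat \<lceil>t\<rceil>"
      have n: "t \<le> real n" "real n \<le> t + 1"
        unfolding n_def by (use t in linarith)+
      have "\<sigma> t \<le> K * real n"
        using mono[OF n(1)] K[of n] by simp
      also have "\<dots> \<le> K * (t + t / h)"
      proof (rule mult_left_mono)
        have "1 \<le> t / h"
          using False h(1) by simp
        then show "real n \<le> t + t / h"
          using n(2) by linarith
      qed (use K0 in simp)
      also have "\<dots> = K * (1 + 1 / h) * t"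
        by (simp add: algebra_simps)
      also have "\<dots> \<le> C * t"
        using t by (intro mult_right_mono) (auto simp: C_def)
      finally show ?thesis .
    qed
  qed
qed

lemma (in reparameterized_flow) rates_eq_if_linear_bounds:
  assumes \<sigma>: "\<sigma> 0 = 0" "strict_mono \<sigma>" "surj \<sigma>" "\<And>t. \<psi> (\<sigma> t) y = \<phi> t y"
    and "0 < c" "0 < C"
    and "\<And>t. 0 < t \<Longrightarrow> c * t \<le> \<sigma> t" "\<And>t. 0 < t \<Longrightarrow> \<sigma> t \<le> C * t"
  shows "lower_rate \<rho> \<psi> x y = lower_rate \<rho> \<phi> x y \<and> upper_rate \<rho> \<psi> x y = upper_rate \<rho> \<phi> x y"
proof -
  have upper: "entrance_time \<psi> A y \<le> ereal C * entrance_time \<phi> A y" for A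
    by (rule entrance_time_change_le[where \<sigma> = \<sigma>]) (use assms in auto)
  have lower: "entrance_time \<phi> A y \<le> ereal (1 / c) * entrance_time \<psi> A y" for A
    by (rule entrance_time_change_ge[where \<sigma> = \<sigma>]) (use assms in auto)
  have "0 < 1 / c"
    using \<open>0 < c\<close> by simp
  then show ?thesis
    using rates_mono[OF \<open>0 < C\<close> upper] rates_mono[OF _ lower] by (blast intro: antisym)
qed

lemma rates_eq_if_same_orbit_map:
  assumes "\<And>t. \<psi> t y = \<phi> t y"
  shows "lower_rate \<rho> \<psi> x y = lower_rate \<rho> \<phi> x y \<and> upper_rate \<rho> \<psi> x y = upper_rate \<rho> \<phi> x y"
proof -
  have "entrance_time \<psi> A y = entrance_time \<phi> A y" for A
    by (simp add: entrance_time_def escape_time_def assms)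
  then have "rate_quotient \<rho> \<psi> x y = rate_quotient \<rho> \<phi> x y"
      "no_entrance \<rho> \<psi> x y \<longleftrightarrow> no_entrance \<rho> \<phi> x y"
    by (simp_all add: rate_quotient_def fun_eq_iff no_entrance_def)
  then show ?thesis
    by (simp add: lower_rate_def upper_rate_def)
qed

locale measure_preserving_reparameterized_flow =
  reparameterized_flow \<phi> \<psi> r + prob_space M
  for \<phi> \<psi> :: "real \<Rightarrow> 'a::{second_countable_topology, t2_space} \<Rightarrow> 'a"
    and r :: "'a \<Rightarrow> real" and M :: "'a measure" +
  assumes borel: "sets M = sets borel"
    and invariant: "distr M borel (\<phi> t) = M"
    and integrable_r: "integrable M r"
    and r_nonneg: "0 \<le> r x"
begin

text \<open>
  The new time that the orbit of \<open>x\<close> takes during one unit of the old time. The conversion to \<open>real\<close>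
  replaces an infinite integral by \<open>0\<close>; off the fixed points the integral is finite.
\<close>

definition unit_time :: "'a \<Rightarrow> real" where
  "unit_time x = enn2real (\<integral>\<^sup>+s. ennreal (r (\<phi> s x)) * indicator {0..1} s \<partial>lborel)"

lemma r_measurable [measurable]: "r \<in> borel_measurable borel"
  using integrable_r measurable_cong_sets[OF borel refl] by blast

lemma flow_measurable [measurable]: "(\<lambda>(t, x). \<phi> t x) \<in> borel_measurable (borel \<Otimes>\<^sub>M borel)"
  unfolding borel_prod by (rule borel_measurable_continuous_onI[OF original.continuous_flow])

lemma time_map_measurable [measurable]: "\<phi> t \<in> measurable M M"
  using borel_measurable_continuous_onI[OF original.continuous_time_map]
  by (simp add: measurable_cong_sets[OF borel borel])

lemma time_map_invariant: "distr M M (\<phi> t) = M"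
proof -
  have "distr M M (\<phi> t) = distr M borel (\<phi> t)"
    by (rule distr_cong) (simp_all add: borel)
  then show ?thesis
    by (simp add: invariant)
qed

lemma funpow_time_one_map: "(\<phi> 1 ^^ n) x = \<phi> (real n) x"
  by (induction n) (simp_all add: original.flow_0 original.flow_add[symmetric] add.commute)

lemma integrand_measurable:
  "(\<lambda>(x, s). ennreal (r (\<phi> s x)) * indicator {0..1} s) \<in> borel_measurable (M \<Otimes>\<^sub>M lborel)"
proof -
  have "(\<lambda>(x, s). ennreal (r (\<phi> s x)) * indicator {0..1} s) \<in>
      borel_measurable (borel \<Otimes>\<^sub>M borel)"
    by measurable
  then show ?thesis
    by (subst measurable_cong_sets[OF sets_pair_measure_cong[OF borel sets_lborel] refl])
qed

text \<open>
  Tonelli's theorem and the invariance of the measure: the integral of \<open>r (\<phi> s x)\<close> over \<open>x\<close> is the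
  integral of \<open>r\<close>, whatever \<open>s\<close> is.
\<close>

lemma integrable_unit_time: "integrable M unit_time"
proof (rule integrableI_nonneg)
  interpret pair_sigma_finite M lborel
    by (intro pair_sigma_finite.intro sigma_finite_measure_axioms lborel.sigma_finite_measure_axioms)
  note [measurable] = integrand_measurable
  have inner: "(\<lambda>x. \<integral>\<^sup>+s. ennreal (r (\<phi> s x)) * indicator {0..1} s \<partial>lborel) \<in> borel_measurable M"
    using lborel.borel_measurable_nn_integral[OF integrand_measurable] by simp
  then show "unit_time \<in> borel_measurable M"
    unfolding unit_time_def[abs_def] by measurable
  have "(\<integral>\<^sup>+x. ennreal (unit_time x) \<partial>M)
      \<le> (\<integral>\<^sup>+x. (\<integral>\<^sup>+s. ennreal (r (\<phi> s x)) * indicator {0..1} s \<partial>lborel) \<partial>M)"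
    by (intro nn_integral_mono) (simp add: unit_time_def ennreal_enn2real_if)
  also have "\<dots> = (\<integral>\<^sup>+s. (\<integral>\<^sup>+x. ennreal (r (\<phi> s x)) * indicator {0..1} s \<partial>M) \<partial>lborel)"
    using Fubini'[OF integrand_measurable] by simp
  also have "\<dots> = (\<integral>\<^sup>+s. (\<integral>\<^sup>+x. ennreal (r x) \<partial>M) * indicator {0..1::real} s \<partial>lborel)"
  proof (rule nn_integral_cong)
    fix s :: real
    have [measurable]: "(\<lambda>x. ennreal (r x)) \<in> borel_measurable M"
      using integrable_r by measurable
    have "(\<integral>\<^sup>+x. ennreal (r x) \<partial>M) = (\<integral>\<^sup>+x. ennreal (r x) \<partial>distr M M (\<phi> s))"
      by (simp only: time_map_invariant)
    also have "\<dots> = (\<integral>\<^sup>+x. ennreal (r (\<phi> s x)) \<partial>M)"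
      by (rule nn_integral_distr) measurable
    finally show "(\<integral>\<^sup>+x. ennreal (r (\<phi> s x)) * indicator {0..1} s \<partial>M)
        = (\<integral>\<^sup>+x. ennreal (r x) \<partial>M) * indicator {0..1} s"
      by (simp add: indicator_def)
  qed
  also have "\<dots> = (\<integral>\<^sup>+x. ennreal (r x) \<partial>M)"
    by (simp add: nn_integral_cmult)
  also have "\<dots> < \<infinity>"
    using integrable_r r_nonneg by (simp add: integrable_iff_bounded)
  finally show "(\<integral>\<^sup>+x. ennreal (unit_time x) \<partial>M) < \<infinity>" .
qed (simp add: unit_time_def)

text \<open>
  The derivative of \<open>\<sigma>\<close> is \<open>r\<close> along the orbit, so the fundamental theorem of calculus identifies the
  unit times with the increments of \<open>\<sigma>\<close>, and their sum telescopes.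
\<close>

lemma birkhoff_sum_unit_time:
  assumes \<sigma>: "\<sigma> 0 = 0" "strict_mono \<sigma>"
    and der: "\<And>t. (\<sigma> has_real_derivative r (\<phi> t x)) (at t)"
  shows "birkhoff_sum (\<phi> 1) unit_time n x = \<sigma> (real n)"
proof -
  have unit: "unit_time (\<phi> (real i) x) = \<sigma> (real (Suc i)) - \<sigma> (real i)" for i
  proof -
    have "(\<integral>\<^sup>+s. ennreal (r (\<phi> s (\<phi> (real i) x))) * indicator {0..1} s \<partial>lborel)
        = ennreal (\<sigma> (1 + real i) - \<sigma> (0 + real i))"
    proof (rule nn_integral_FTC_Icc)
      show "(\<lambda>s. r (\<phi> s (\<phi> (real i) x))) \<in> borel_measurable borel"
        by measurable
      show "((\<lambda>s. \<sigma> (s + real i)) has_real_derivative r (\<phi> s (\<phi> (real i) x))) (at s)" for s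
        using der[of "s + real i"] DERIV_shift[of \<sigma> _ s "real i"]
        by (simp add: original.flow_add)
    qed (simp_all add: r_nonneg)
    moreover have "\<sigma> (real i) \<le> \<sigma> (1 + real i)"
      using strict_mono_less_eq[OF \<sigma>(2)] by simp
    ultimately show ?thesis
      by (simp add: unit_time_def)
  qed
  have "birkhoff_sum (\<phi> 1) unit_time n x = (\<Sum>i<n. \<sigma> (real (Suc i)) - \<sigma> (real i))"
    by (simp only: birkhoff_sum_def funpow_time_one_map unit)
  also have "\<dots> = \<sigma> (real n)"
    using sum_lessThan_telescope[of "\<lambda>i. \<sigma> (real i)" n] \<sigma>(1) by simp
  finally show ?thesis .
qed

text \<open>
  A point \<open>y\<close> is exceptional only if it is not fixed and its elapsed new time fails to grow linearly,
  which does not involve the centre \<open>x\<close>. So the statement holds for all centres \<open>x\<close> at once, in particular for \<open>x = y\<close>.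
\<close>

lemma AE_rates_eq:
  "AE y in M. \<forall>x. lower_rate \<rho> \<psi> x y = lower_rate \<rho> \<phi> x y \<and>
    upper_rate \<rho> \<psi> x y = upper_rate \<rho> \<phi> x y"
proof -
  have nonneg: "0 \<le> unit_time x" for x
    by (simp add: unit_time_def)
  show ?thesis
    using AE_birkhoff_sum_bounded[OF time_map_measurable[of 1] time_map_invariant integrable_unit_time nonneg]
      AE_birkhoff_sum_linear_growth[OF time_map_measurable[of 1] time_map_invariant integrable_unit_time nonneg]
  proof eventually_elim
    case (elim y)
    show ?case
    proof (cases "y \<in> fixed_points \<phi>")
      case True
      then have "\<psi> t y = \<phi> t y" for t
        using fixed_reparameterized_iff[of y] by (simp add: fixed_points_def)
      then show ?thesis
        using rates_eq_if_same_orbit_map[of \<psi> y \<phi> \<rho>] by blast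
    next
      case False
      obtain \<sigma> where \<sigma>: "\<sigma> 0 = 0" "strict_mono \<sigma>" "surj \<sigma>"
          "\<And>t. (\<sigma> has_real_derivative r (\<phi> t y)) (at t)"
          "\<And>t. \<psi> (\<sigma> t) y = \<phi> t y"
        using new_time[OF False] by blast
      have sum: "birkhoff_sum (\<phi> 1) unit_time n y = \<sigma> (real n)" for n
        using \<sigma>(1,2,4) by (rule birkhoff_sum_unit_time)
      have "unit_time y = \<sigma> 1"
        using sum[of 1] by (simp add: birkhoff_sum_def)
      moreover have "0 < \<sigma> 1"
        using strict_mono_less[OF \<sigma>(2), of 0 1] \<sigma>(1) by simp
      ultimately obtain \<delta> K where "0 < \<delta>" "\<And>n. \<delta> * real n \<le> \<sigma> (real n)" "\<And>n. \<sigma> (real n) \<le> K * real n"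
        using elim unfolding sum by auto
      moreover have "(\<sigma> has_real_derivative r y) (at 0)" "0 < r y"
        using \<sigma>(4)[of 0] r_pos[OF False] by (simp_all add: original.flow_0)
      ultimately obtain c C where "0 < c" "0 < C"
          "\<And>t. 0 < t \<Longrightarrow> c * t \<le> \<sigma> t" "\<And>t. 0 < t \<Longrightarrow> \<sigma> t \<le> C * t"
        using linear_bounds_from_integer_times[OF \<sigma>(1,2)] by metis
      then show ?thesis
        using rates_eq_if_linear_bounds[OF \<sigma>(1,2,3,5)] by blast
    qed
  qed
qed

end

section \<open>Time reparameterizations of flows on manifolds\<close>

lemma Ck_flow_imp_topological_flow: "Ck_flow k \<A> \<phi> \<Longrightarrow> topological_flow \<phi>"
  by (simp add: Ck_flow_def topological_flow_def)

theorem theorem5: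
  fixes \<A> :: "('a::{second_countable_topology, t2_space}, 'e::euclidean_space) chart set"
    and g :: "('a, 'e) chart \<Rightarrow> 'a \<Rightarrow> 'e \<Rightarrow> 'e \<Rightarrow> real"
    and f :: "('a, 'e) chart \<Rightarrow> 'a \<Rightarrow> 'e"
    and \<phi> \<phi>\<^sub>r :: "real \<Rightarrow> 'a \<Rightarrow> 'a"
    and r :: "'a \<Rightarrow> real"
    and \<mu> :: "'a measure"
    and \<rho> :: "'a \<Rightarrow> 'a \<Rightarrow> ennreal"
    and m l :: nat
  assumes "2 \<le> m" and "1 \<le> l" and "l < m"
    and "Ck_manifold m \<A>"
    and "Ck_riemannian_metric (m - 1) \<A> g"
    and "\<rho> = riemannian_dist \<A> g"
    and "Ck_vector_field l \<A> f"
    and "Ck_flow l \<A> \<phi>"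
    and "generated_by \<A> f \<phi>"
    and "\<mu> \<in> invariant_measures \<phi>"
    and "time_reparameterization l \<A> \<phi> \<phi>\<^sub>r"
    and "associated_function l \<A> \<phi> \<phi>\<^sub>r r"
    and "integrable \<mu> r"
  shows "(AE x in \<mu>. lower_recurrence_rate \<rho> \<phi>\<^sub>r x = lower_recurrence_rate \<rho> \<phi> x \<and>
                     upper_recurrence_rate \<rho> \<phi>\<^sub>r x = upper_recurrence_rate \<rho> \<phi> x) \<and>
         (non_atomic \<phi> \<mu> \<longrightarrow>
           (\<forall>x. AE y in \<mu>. lower_rate \<rho> \<phi>\<^sub>r x y = lower_rate \<rho> \<phi> x y \<and>
                            upper_rate \<rho> \<phi>\<^sub>r x y = upper_rate \<rho> \<phi> x y))"
proof -
  have flows: "topological_flow \<phi>" "topological_flow \<phi>\<^sub>r"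
    using assms(8,11) by (auto simp: time_reparameterization_def intro: Ck_flow_imp_topological_flow)
  have orbit: "orbit \<phi>\<^sub>r x = orbit \<phi> x" for x
    using assms(11) by (simp add: time_reparameterization_def)
  have r: "0 \<le> r x" "x \<notin> fixed_points \<phi> \<Longrightarrow> 0 < r x" for x
    using assms(12) by (auto simp: associated_function_def)
  have time_change: "\<exists>\<theta>. time_change \<phi> \<phi>\<^sub>r x \<theta> \<and> (\<theta> has_real_derivative inverse (r x)) (at 0)"
    if x: "x \<notin> fixed_points \<phi>" for x
  proof -
    obtain \<theta> d where "time_change \<phi> \<phi>\<^sub>r x \<theta>" "(\<theta> has_real_derivative d) (at 0)" "r x = inverse d"
      using assms(12) x unfolding associated_function_def by blast
    then show ?thesis
      by auto
  qed
  have \<mu>: "prob_space \<mu>" "sets \<mu> = sets borel" "distr \<mu> borel (\<phi> t) = \<mu>" for t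
    using assms(10) by (auto simp: invariant_measures_def)
  interpret measure_preserving_reparameterized_flow \<phi> \<phi>\<^sub>r r \<mu>
    using flows orbit r time_change \<mu> assms(13)
    by (intro measure_preserving_reparameterized_flow.intro reparameterized_flow.intro
        reparameterized_flow_axioms.intro measure_preserving_reparameterized_flow_axioms.intro)
  have "AE y in \<mu>. \<forall>x. lower_rate \<rho> \<phi>\<^sub>r x y = lower_rate \<rho> \<phi> x y \<and>
      upper_rate \<rho> \<phi>\<^sub>r x y = upper_rate \<rho> \<phi> x y"
    by (rule AE_rates_eq)
  then show ?thesis
    by (auto elim: eventually_mono)
qed

end
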